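(* Let $\mathcal{C}$ be a $\mathbb{Z}_2R$ linear self-dual code of type $(\alpha,\beta;\gamma,\delta;\kappa)$ with generator matrix $G=(G_1|G_2)$, and let $\mathcal{C}'$ be a $\mathbb{Z}_2R$ linear self-dual code of type $(\alpha',\beta';\gamma',\delta';\kappa')$ with generator matrix $G'=(G_1'|G_2')$, where $G_1,G_1'$ are the parts over $\mathbb{Z}_2$ and $G_2,G_2'$ the parts over $R$. Then $$\left(\begin{array}{cc|cc}G_1&0&G_2&0\\0&G_1'&0&G_2'\end{array}\right)$$ generates a self-dual code $\mathcal{M}$ of type $(\alpha+\alpha',\beta+\beta';\gamma+\gamma',\delta+\delta';\kappa+\kappa')$. Moreover, $W_{\mathcal{M}}(X,Y)=W_{\mathcal{C}}(X,Y)\,W_{\mathcal{C}'}(X,Y)$.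
   Context: Let $R=\mathbb{Z}_2+u\mathbb{Z}_2=\{0,1,u,1+u\}$ with $u^2=0$, and $\eta:R\to\mathbb{Z}_2$, $\eta(r+uq)=r$. The set $\mathbb{Z}_2^\alpha\times R^\beta$ is an $R$-module under $d(a_1,\dots,a_\alpha\mid b_1,\dots,b_\beta)=(\eta(d)a_1,\dots,\eta(d)a_\alpha\mid db_1,\dots,db_\beta)$. A $\mathbb{Z}_2R$ linear code is an $R$-submodule $\mathcal{C}$ of $\mathbb{Z}_2^\alpha\times R^\beta$; a generator matrix is a matrix whose rows generate $\mathcal{C}$ as an $R$-module. The code has type $(\alpha,\beta;\gamma,\delta;\kappa)$ if $\mathcal{C}\cong(R/uR)^\gamma\oplus R^\delta$ as an $R$-module (so $|\mathcal{C}|=2^{\gamma+2\delta}$) and $\kappa=\dim_{\mathbb{Z}_2}(\mathcal{C}_b)_X$, where $\mathcal{C}_b$ is the subcode of codewords whose last $\beta$ coordinates all lie in $\{0,u\}$ and $(\cdot)_X$ denotes projection onto the first $\alpha$ coordinates ($\kappa=0$ if $\alpha=0$); the generator matrices here have $\gamma+\delta$ (resp. $\gamma'+\delta'$) rows. The inner product is $\langle(\mathbf v|\mathbf w),(\mathbf x|\mathbf y)\rangle=u\sum_{i=1}^\alpha v_ix_i+\sum_{j=1}^\beta w_jy_j\in R$; $\mathcal{C}^\perp$ is the set of vectors orthogonal to all of $\mathcal{C}$; $\mathcal{C}$ is self-dual if $\mathcal{C}=\mathcal{C}^\perp$. The Lee weight on $R$ is $wt_L(0)=0$, $wt_L(1)=wt_L(1+u)=1$,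 $wt_L(u)=2$, extended additively to $R^\beta$, and $wt_L(\mathbf v|\mathbf w)=wt_H(\mathbf v)+wt_L(\mathbf w)$, where $wt_H$ is the Hamming weight. The weight enumerator is $W_{\mathcal{C}}(X,Y)=\sum_{c\in\mathcal{C}}X^{n-wt_L(c)}Y^{wt_L(c)}$ with $n=\alpha+2\beta$. *)

theory Defs
  imports
    "HOL-Library.Z2"
    "HOL-Algebra.QuotRing"
    "Jordan_Normal_Form.VS_Connect"
begin

text \<open>\<open>Z2u r q\<close> is the element \<open>r + u q\<close>; the selector \<open>eta\<close> is reduction modulo \<open>u\<close>.\<close>

datatype z2u = Z2u (eta: bit) (ucoeff: bit)

instantiation z2u :: comm_ring_1
begin

definition "0 = Z2u 0 0"
definition "1 = Z2u 1 0"
definition "x + y = Z2u (eta x + eta y) (ucoeff x + ucoeff y)"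
definition "x - y = Z2u (eta x - eta y) (ucoeff x - ucoeff y)"
definition "- x = Z2u (- eta x) (- ucoeff x)"
definition "x * y = Z2u (eta x * eta y) (eta x * ucoeff y + ucoeff x * eta y)"

instance
proof
  fix x y z :: z2u
  show "x * y * z = x * (y * z)"
    by (simp only: times_z2u_def z2u.sel distrib_left distrib_right mult.assoc add.assoc)
  show "x * y = y * x"
    by (simp only: times_z2u_def mult.commute add.commute)
  show "(x + y) * z = x * z + y * z"
    by (simp only: times_z2u_def plus_z2u_def z2u.sel distrib_right add_ac)
  show "x + y + z = x + (y + z)" "x + y = y + x"
    by (simp_all only: plus_z2u_def z2u.sel add_ac)
  show "0 + x = x" "1 * x = x" "- x + x = 0" "x - y = x + - y" "(0 :: z2u) \<noteq> 1"
    by (cases x; cases y; simp add: zero_z2u_def one_z2u_def plus_z2u_def minus_z2u_def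
        uminus_z2u_def times_z2u_def)+
qed

end

definition u :: z2u where "u = Z2u 0 1"

definition of_Z2 :: "bit \<Rightarrow> z2u" where "of_Z2 r = Z2u r 0"

lemma z2u_eq: "Z2u r q = of_Z2 r + u * of_Z2 q"
  by (simp add: u_def of_Z2_def plus_z2u_def times_z2u_def)

lemma u_square: "u * u = 0"
  by (simp add: u_def zero_z2u_def times_z2u_def)

lemma UNIV_z2u: "(UNIV :: z2u set) = {0, 1, u, 1 + u}"
proof -
  have "x \<in> {0, 1, u, 1 + u}" for x :: z2u
    by (cases x, rename_tac r q, case_tac r; case_tac q)
      (simp_all add: zero_z2u_def one_z2u_def u_def plus_z2u_def)
  then show ?thesis by blast
qed

instance z2u :: finite
  by standard (simp add: UNIV_z2u)

definition Z2_power :: "nat \<Rightarrow> (z2u, bit vec) module" where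
  "Z2_power \<alpha> =
    \<lparr>carrier = carrier_vec \<alpha>, mult = undefined, one = undefined,
     zero = 0\<^sub>v \<alpha>, add = (+), smult = (\<lambda>d a. eta d \<cdot>\<^sub>v a)\<rparr>"

definition ambient :: "nat \<Rightarrow> nat \<Rightarrow> (z2u, bit vec \<times> z2u vec) module" where
  "ambient \<alpha> \<beta> = direct_sum (Z2_power \<alpha>) (module_vec TYPE(z2u) \<beta>)"

lemma module_ambient: "module class_ring (ambient \<alpha> \<beta>)"
proof -
  have neg: "\<exists>y\<in>carrier_vec \<alpha>. x + y = 0\<^sub>v \<alpha>" if "x \<in> carrier_vec \<alpha>" for x :: "bit vec"
    using that by (intro bexI[of _ "- x"]) auto
  have neg': "\<exists>y\<in>carrier_vec \<beta>. x + y = 0\<^sub>v \<beta>" if "x \<in> carrier_vec \<beta>" for x :: "z2u vec"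
    using that by (intro bexI[of _ "- x"]) auto
  have "module class_ring (Z2_power \<alpha>)"
    unfolding Z2_power_def
    by (intro moduleI abelian_groupI class_cring.is_cring)
      (auto simp: neg plus_z2u_def times_z2u_def one_z2u_def add_smult_distrib_vec
        smult_add_distrib_vec smult_smult_assoc assoc_add_vec comm_add_vec)
  moreover have "module class_ring (module_vec TYPE(z2u) \<beta>)"
    unfolding module_vec_def
    by (intro moduleI abelian_groupI class_cring.is_cring)
      (auto simp: neg' add_smult_distrib_vec smult_add_distrib_vec smult_smult_assoc
        assoc_add_vec comm_add_vec)
  ultimately show ?thesis
    unfolding ambient_def by (rule direct_sum_is_module)
qed

definition linear_code :: "nat \<Rightarrow> nat \<Rightarrow> (bit vec \<times> z2u vec) set \<Rightarrow> bool" where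
  "linear_code \<alpha> \<beta> C \<longleftrightarrow> LinearCombinations.submodule class_ring C (ambient \<alpha> \<beta>)"

text \<open>A matrix \<open>(G1 | G2)\<close> is given by its parts over \<open>Z2\<close> and over \<open>R\<close>. Its rows need not be
  pairwise distinct.\<close>

definition matrix_rows :: "bit mat \<Rightarrow> z2u mat \<Rightarrow> (bit vec \<times> z2u vec) set" where
  "matrix_rows G1 G2 = {(row G1 i, row G2 i) | i. i < dim_row G1}"

definition generator_matrix ::
    "nat \<Rightarrow> nat \<Rightarrow> nat \<Rightarrow> bit mat \<Rightarrow> z2u mat \<Rightarrow> (bit vec \<times> z2u vec) set \<Rightarrow> bool" where
  "generator_matrix \<alpha> \<beta> m G1 G2 C \<longleftrightarrow>
    G1 \<in> carrier_mat m \<alpha> \<and> G2 \<in> carrier_mat m \<beta> \<and>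
    C = LinearCombinations.module.span class_ring (ambient \<alpha> \<beta>) (matrix_rows G1 G2)"

text \<open>The \<open>R\<close>-module \<open>R/uR\<close>, whose elements are the cosets of the principal ideal \<open>uR\<close>;
  \<open>d\<close> acts as multiplication by the coset of \<open>d\<close>.\<close>

definition uR :: "z2u set" where "uR = PIdl\<^bsub>class_ring\<^esub> u"

definition R_mod_uR :: "(z2u, z2u set) module" where
  "R_mod_uR = (let Q = class_ring Quot uR in
    \<lparr>carrier = carrier Q, mult = mult Q, one = one Q, zero = zero Q, add = add Q,
     smult = (\<lambda>d X. (uR +>\<^bsub>class_ring\<^esub> d) \<otimes>\<^bsub>Q\<^esub> X)\<rparr>)"

definition power_module :: "('r, 'm) module \<Rightarrow> nat \<Rightarrow> ('r, 'm vec) module" where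
  "power_module M n =
    \<lparr>carrier = {v \<in> carrier_vec n. \<forall>i<n. v $ i \<in> carrier M}, mult = undefined, one = undefined,
     zero = vec n (\<lambda>i. \<zero>\<^bsub>M\<^esub>), add = (\<lambda>v w. vec n (\<lambda>i. v $ i \<oplus>\<^bsub>M\<^esub> w $ i)),
     smult = (\<lambda>d v. vec n (\<lambda>i. d \<odot>\<^bsub>M\<^esub> v $ i))\<rparr>"

definition module_iso :: "('r, 'c) ring_scheme \<Rightarrow> ('r, 'm) module \<Rightarrow> ('r, 'n) module \<Rightarrow> bool" where
  "module_iso R M N \<longleftrightarrow> (\<exists>f \<in> LinearCombinations.module_hom R M N. bij_betw f (carrier M) (carrier N))"

definition subcode_b :: "(bit vec \<times> z2u vec) set \<Rightarrow> (bit vec \<times> z2u vec) set" where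
  "subcode_b C = {(a, b) \<in> C. \<forall>j < dim_vec b. b $ j \<in> {0, u}}"

definition code_kappa :: "nat \<Rightarrow> (bit vec \<times> z2u vec) set \<Rightarrow> nat" where
  "code_kappa \<alpha> C = vectorspace.dim class_ring
    ((module_vec TYPE(bit) \<alpha>)\<lparr>carrier := fst ` subcode_b C\<rparr>)"

definition has_type ::
    "nat \<Rightarrow> nat \<Rightarrow> nat \<Rightarrow> nat \<Rightarrow> nat \<Rightarrow> (bit vec \<times> z2u vec) set \<Rightarrow> bool" where
  "has_type \<alpha> \<beta> \<gamma> \<delta> \<kappa> C \<longleftrightarrow>
    linear_code \<alpha> \<beta> C \<and>
    module_iso class_ring ((ambient \<alpha> \<beta>)\<lparr>carrier := C\<rparr>)
      (direct_sum (power_module R_mod_uR \<gamma>) (module_vec TYPE(z2u) \<delta>)) \<and>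
    \<kappa> = code_kappa \<alpha> C"

text \<open>The sum over the binary coordinates is taken in the subring \<open>Z2\<close> of \<open>R\<close>.\<close>

definition inner_product :: "bit vec \<times> z2u vec \<Rightarrow> bit vec \<times> z2u vec \<Rightarrow> z2u" where
  "inner_product x y = u * of_Z2 (fst x \<bullet> fst y) + snd x \<bullet> snd y"

definition dual_code ::
    "nat \<Rightarrow> nat \<Rightarrow> (bit vec \<times> z2u vec) set \<Rightarrow> (bit vec \<times> z2u vec) set" where
  "dual_code \<alpha> \<beta> C = {x \<in> carrier (ambient \<alpha> \<beta>). \<forall>c\<in>C. inner_product x c = 0}"

definition self_dual :: "nat \<Rightarrow> nat \<Rightarrow> (bit vec \<times> z2u vec) set \<Rightarrow> bool" where
  "self_dual \<alpha> \<beta> C \<longleftrightarrow> linear_code \<alpha> \<beta> C \<and> C = dual_code \<alpha> \<beta> C"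

definition hamming_weight :: "bit vec \<Rightarrow> nat" where
  "hamming_weight v = card {i. i < dim_vec v \<and> v $ i \<noteq> 0}"

definition lee_weight_R :: "z2u \<Rightarrow> nat" where
  "lee_weight_R x = (if x = 0 then 0 else if x = u then 2 else 1)"

definition lee_weight :: "bit vec \<times> z2u vec \<Rightarrow> nat" where
  "lee_weight c = hamming_weight (fst c) + (\<Sum>j<dim_vec (snd c). lee_weight_R (snd c $ j))"

text \<open>\<open>Z[X,Y]\<close> is represented as \<open>Z[Y][X]\<close>. The truncated subtraction in the exponent is harmless:
  a vector of the ambient space has Lee weight at most \<open>\<alpha> + 2\<beta>\<close>.\<close>

definition var_X :: "int poly poly" where "var_X = [:0, 1:]"
definition var_Y :: "int poly poly" where "var_Y = [:[:0, 1:]:]"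

definition weight_enumerator ::
    "nat \<Rightarrow> nat \<Rightarrow> (bit vec \<times> z2u vec) set \<Rightarrow> int poly poly" where
  "weight_enumerator \<alpha> \<beta> C =
    (\<Sum>c\<in>C. var_X ^ (\<alpha> + 2 * \<beta> - lee_weight c) * var_Y ^ lee_weight c)"

end

theory Submission
  imports Defs
begin

text \<open>The block matrix generates the image of \<open>C \<times> C'\<close> under coordinatewise concatenation. This map is
  an isomorphism of \<open>R\<close>-modules onto its image, under which the inner product and the Lee weight are
  additive. The dual of a product is therefore the product of the duals, since either component may
  be tested against \<open>0\<close> in the other; the types add up and the weight enumerators multiply.\<close>

text \<open>The parameters of the type need two separate arguments. The isomorphism class of the
  module determines \<gamma> and \<delta>, but \<kappa> depends on the coordinates: (1 | 0) and (0 |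
  u) both generate a copy of R/uR, with \<kappa> = 1 and \<kappa> = 0 respectively. So \<gamma> and
  \<delta> come from a chain of R-isomorphisms, while \<kappa> is the dimension over Z2 of a space
  of binary words that has to be described explicitly. Concatenation acts at three levels: on
  codewords, on the projected binary words, and on the elements of (R/uR)^\<gamma> + R^\<delta>. The
  first and the last are pairs of vectors with different entry types, hence the polymorphism of
  \<open>append_pair\<close>.\<close>

definition append_pair :: "'a vec \<times> 'b vec \<Rightarrow> 'a vec \<times> 'b vec \<Rightarrow> 'a vec \<times> 'b vec" where
  "append_pair x y = (fst x @\<^sub>v fst y, snd x @\<^sub>v snd y)"

definition code_prod ::
    "('a vec \<times> 'b vec) set \<Rightarrow> ('a vec \<times> 'b vec) set \<Rightarrow> ('a vec \<times> 'b vec) set" where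
  "code_prod C D = (\<lambda>(x, y). append_pair x y) ` (C \<times> D)"

lemma append_pair_simps [simp]: "append_pair (a, b) (c, d) = (a @\<^sub>v c, b @\<^sub>v d)"
  by (simp add: append_pair_def)

section \<open>Operations of the modules and of concatenated vectors\<close>

lemma ambient_simps [simp]:
  "carrier (ambient m n) = carrier_vec m \<times> carrier_vec n"
  "\<zero>\<^bsub>ambient m n\<^esub> = (0\<^sub>v m, 0\<^sub>v n)"
  "x \<oplus>\<^bsub>ambient m n\<^esub> y = (fst x + fst y, snd x + snd y)"
  "d \<odot>\<^bsub>ambient m n\<^esub> x = (eta d \<cdot>\<^sub>v fst x, d \<cdot>\<^sub>v snd x)"
  by (simp_all add: ambient_def direct_sum_def Z2_power_def module_vec_def)

lemma direct_sum_simps [simp]: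
  "carrier (direct_sum M N) = carrier M \<times> carrier N"
  "\<zero>\<^bsub>direct_sum M N\<^esub> = (\<zero>\<^bsub>M\<^esub>, \<zero>\<^bsub>N\<^esub>)"
  "x \<oplus>\<^bsub>direct_sum M N\<^esub> y = (fst x \<oplus>\<^bsub>M\<^esub> fst y, snd x \<oplus>\<^bsub>N\<^esub> snd y)"
  "d \<odot>\<^bsub>direct_sum M N\<^esub> x = (d \<odot>\<^bsub>M\<^esub> fst x, d \<odot>\<^bsub>N\<^esub> snd x)"
  by (simp_all add: direct_sum_def)

lemma power_module_simps [simp]:
  "carrier (power_module M n) = {v \<in> carrier_vec n. \<forall>i<n. v $ i \<in> carrier M}"
  "v \<oplus>\<^bsub>power_module M n\<^esub> w = vec n (\<lambda>i. v $ i \<oplus>\<^bsub>M\<^esub> w $ i)"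
  "d \<odot>\<^bsub>power_module M n\<^esub> v = vec n (\<lambda>i. d \<odot>\<^bsub>M\<^esub> v $ i)"
  by (simp_all add: power_module_def)

lemma smult_append_vec: "c \<cdot>\<^sub>v (v @\<^sub>v w) = (c \<cdot>\<^sub>v v) @\<^sub>v (c \<cdot>\<^sub>v w)"
  by (intro eq_vecI) auto

lemma smult_zero_vec: "(c :: 'a :: mult_zero) \<cdot>\<^sub>v 0\<^sub>v n = 0\<^sub>v n"
  by (intro eq_vecI) auto

lemma append_vec_plus:
  assumes "v \<in> carrier_vec k" "x \<in> carrier_vec k"
    and "v' \<in> carrier_vec l" "x' \<in> carrier_vec l"
  shows "(v + x) @\<^sub>v (v' + x') = (v @\<^sub>v v') + (x @\<^sub>v x')"
  using assms by (rule append_vec_add[symmetric])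

lemma zero_append_vec: "0\<^sub>v m @\<^sub>v 0\<^sub>v n = 0\<^sub>v (m + n)"
  by (intro eq_vecI) auto

lemma carrier_vec_add_cases:
  assumes "v \<in> carrier_vec (m + n)"
  obtains a b where "a \<in> carrier_vec m" "b \<in> carrier_vec n" "v = a @\<^sub>v b"
  using assms by (metis vec_first_carrier vec_first_last_append vec_last_carrier)

section \<open>Linear codes and their products\<close>

lemma linear_code_iff:
  "linear_code m n C \<longleftrightarrow> C \<subseteq> carrier_vec m \<times> carrier_vec n \<and> (0\<^sub>v m, 0\<^sub>v n) \<in> C \<and>
    (\<forall>a b c d. (a, b) \<in> C \<longrightarrow> (c, d) \<in> C \<longrightarrow> (a + c, b + d) \<in> C) \<and>
    (\<forall>r a b. (a, b) \<in> C \<longrightarrow> (eta r \<cdot>\<^sub>v a, r \<cdot>\<^sub>v b) \<in> C)"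
  by (auto simp: linear_code_def submodule_def module_ambient)

lemma mem_code_prod_iff:
  "(a, b) \<in> code_prod C D \<longleftrightarrow>
    (\<exists>v w v' w'. (v, w) \<in> C \<and> (v', w') \<in> D \<and> a = v @\<^sub>v v' \<and> b = w @\<^sub>v w')"
  by (force simp: code_prod_def append_pair_def)

lemma code_prodI: "(v, w) \<in> C \<Longrightarrow> (v', w') \<in> D \<Longrightarrow> (v @\<^sub>v v', w @\<^sub>v w') \<in> code_prod C D"
  by (auto simp: mem_code_prod_iff)

lemma code_prod_carrier:
  assumes "C \<subseteq> carrier_vec m \<times> carrier_vec n" and "D \<subseteq> carrier_vec m' \<times> carrier_vec n'"
  shows "code_prod C D \<subseteq> carrier_vec (m + m') \<times> carrier_vec (n + n')"
  using assms by (fastforce simp: code_prod_def append_pair_def)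

lemma linear_code_code_prod:
  assumes "linear_code m n C" and "linear_code m' n' D"
  shows "linear_code (m + m') (n + n') (code_prod C D)"
proof -
  note C = assms(1)[unfolded linear_code_iff] and D = assms(2)[unfolded linear_code_iff]
  note mem = mem_code_prod_iff
  show ?thesis
    unfolding linear_code_iff
  proof (intro conjI allI impI)
    show "code_prod C D \<subseteq> carrier_vec (m + m') \<times> carrier_vec (n + n')"
      by (rule code_prod_carrier) (use C D in auto)
    show "(0\<^sub>v (m + m'), 0\<^sub>v (n + n')) \<in> code_prod C D"
      unfolding mem zero_append_vec[symmetric] using C D by blast
  next
    fix a b c d assume "(a, b) \<in> code_prod C D" "(c, d) \<in> code_prod C D"
    then obtain v w v' w' x y x' y' where
      *: "(v, w) \<in> C" "(v', w') \<in> D" "a = v @\<^sub>v v'" "b = w @\<^sub>v w'"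
        "(x, y) \<in> C" "(x', y') \<in> D" "c = x @\<^sub>v x'" "d = y @\<^sub>v y'"
      unfolding mem by auto
    then have "v \<in> carrier_vec m" "w \<in> carrier_vec n" "x \<in> carrier_vec m" "y \<in> carrier_vec n"
      "v' \<in> carrier_vec m'" "w' \<in> carrier_vec n'" "x' \<in> carrier_vec m'" "y' \<in> carrier_vec n'"
      using C D by auto
    then have "a + c = (v + x) @\<^sub>v (v' + x')" "b + d = (w + y) @\<^sub>v (w' + y')"
      using * by (auto simp: append_vec_plus)
    moreover have "(v + x, w + y) \<in> C" "(v' + x', w' + y') \<in> D"
      using * C D by auto
    ultimately show "(a + c, b + d) \<in> code_prod C D"
      unfolding mem by blast
  next
    fix r a b assume "(a, b) \<in> code_prod C D"
    then obtain v w v' w' where *: "(v, w) \<in> C" "(v', w') \<in> D" "a = v @\<^sub>v v'" "b = w @\<^sub>v w'"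
      unfolding mem by auto
    moreover have "(eta r \<cdot>\<^sub>v v, r \<cdot>\<^sub>v w) \<in> C" "(eta r \<cdot>\<^sub>v v', r \<cdot>\<^sub>v w') \<in> D"
      using * C D by auto
    ultimately show "(eta r \<cdot>\<^sub>v a, r \<cdot>\<^sub>v b) \<in> code_prod C D"
      unfolding mem by (auto simp: smult_append_vec)
  qed
qed

section \<open>Generation by the block matrix\<close>

lemma span_subset_linear_code:
  assumes "linear_code m n D" and "S \<subseteq> D"
  shows "LinearCombinations.module.span class_ring (ambient m n) S \<subseteq> D"
  using assms module.span_is_subset[OF module_ambient] by (auto simp: linear_code_def)

text \<open>Padding with zeros is R-linear, so it pulls submodules back to submodules. A pulled-back
  submodule that contains the rows of one matrix then contains their whole span, without any
  handling of linear combinations.\<close>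

lemma linear_code_append_zero:
  assumes "linear_code (m + m') (n + n') E"
  shows "linear_code m n {x \<in> carrier_vec m \<times> carrier_vec n. append_pair x (0\<^sub>v m', 0\<^sub>v n') \<in> E}"
    and "linear_code m' n' {x \<in> carrier_vec m' \<times> carrier_vec n'. append_pair (0\<^sub>v m, 0\<^sub>v n) x \<in> E}"
proof -
  note E = assms[unfolded linear_code_iff]
  have right: "(a + c) @\<^sub>v 0\<^sub>v l = (a @\<^sub>v 0\<^sub>v l) + (c @\<^sub>v 0\<^sub>v l)"
    and left: "0\<^sub>v l @\<^sub>v (a + c) = (0\<^sub>v l @\<^sub>v a) + (0\<^sub>v l @\<^sub>v c)"
    if "a \<in> carrier_vec k" "c \<in> carrier_vec k" for a c :: "'c::comm_monoid_add vec" and k l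
    using append_vec_plus[OF that, of "0\<^sub>v l" l "0\<^sub>v l"]
      append_vec_plus[of "0\<^sub>v l" l "0\<^sub>v l", OF _ _ that] by simp_all
  have smult: "(r \<cdot>\<^sub>v a) @\<^sub>v 0\<^sub>v l = r \<cdot>\<^sub>v (a @\<^sub>v 0\<^sub>v l)" "0\<^sub>v l @\<^sub>v (r \<cdot>\<^sub>v a) = r \<cdot>\<^sub>v (0\<^sub>v l @\<^sub>v a)"
    for r :: "'c::comm_ring_1" and a l
    by (simp_all add: smult_append_vec smult_zero_vec)
  show "linear_code m n {x \<in> carrier_vec m \<times> carrier_vec n. append_pair x (0\<^sub>v m', 0\<^sub>v n') \<in> E}"
    unfolding linear_code_iff using E by (auto simp: zero_append_vec right smult)
  show "linear_code m' n' {x \<in> carrier_vec m' \<times> carrier_vec n'. append_pair (0\<^sub>v m, 0\<^sub>v n) x \<in> E}"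
    unfolding linear_code_iff using E by (auto simp: zero_append_vec left smult)
qed

lemma matrix_rows_image: "matrix_rows G1 G2 = (\<lambda>i. (row G1 i, row G2 i)) ` {..<dim_row G1}"
  by (auto simp: matrix_rows_def)

text \<open>Both inclusions rest on minimality of a span: the product is a submodule containing the
  block rows, and the span of the block rows contains each factor padded with zeros.\<close>

lemma generator_matrix_code_prod:
  assumes "generator_matrix m n k G1 G2 C" and "generator_matrix m' n' k' G1' G2' D"
    and C: "linear_code m n C" and D: "linear_code m' n' D"
  shows "generator_matrix (m + m') (n + n') (k + k')
    (four_block_mat G1 (0\<^sub>m k m') (0\<^sub>m k' m) G1')
    (four_block_mat G2 (0\<^sub>m k n') (0\<^sub>m k' n) G2') (code_prod C D)"
proof -
  let ?B1 = "four_block_mat G1 (0\<^sub>m k m') (0\<^sub>m k' m) G1'"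
  let ?B2 = "four_block_mat G2 (0\<^sub>m k n') (0\<^sub>m k' n) G2'"
  let ?span = "\<lambda>m n. LinearCombinations.module.span class_ring (ambient m n)"
  let ?E = "?span (m + m') (n + n') (matrix_rows ?B1 ?B2)"
  have G: "G1 \<in> carrier_mat k m" "G2 \<in> carrier_mat k n"
      "G1' \<in> carrier_mat k' m'" "G2' \<in> carrier_mat k' n'"
    and CG: "C = ?span m n (matrix_rows G1 G2)" and DG: "D = ?span m' n' (matrix_rows G1' G2')"
    using assms by (auto simp: generator_matrix_def)
  note Ci = C[unfolded linear_code_iff] and Di = D[unfolded linear_code_iff]
  have rowsG: "matrix_rows G1 G2 \<subseteq> carrier_vec m \<times> carrier_vec n"
    "matrix_rows G1' G2' \<subseteq> carrier_vec m' \<times> carrier_vec n'"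
    using G by (auto simp: matrix_rows_def)
  have inC: "matrix_rows G1 G2 \<subseteq> C"
    unfolding CG by (rule module.in_own_span[OF module_ambient]) (use rowsG in simp)
  have inD: "matrix_rows G1' G2' \<subseteq> D"
    unfolding DG by (rule module.in_own_span[OF module_ambient]) (use rowsG in simp)
  have row1: "(row ?B1 i, row ?B2 i) = append_pair (row G1 i, row G2 i) (0\<^sub>v m', 0\<^sub>v n')" if "i < k" for i
    using that G row_four_block_mat(1)[OF G(1) _ _ G(3), of "0\<^sub>m k m'" "0\<^sub>m k' m" i]
      row_four_block_mat(1)[OF G(2) _ _ G(4), of "0\<^sub>m k n'" "0\<^sub>m k' n" i]
    by simp
  have row2: "(row ?B1 (k + i), row ?B2 (k + i)) = append_pair (0\<^sub>v m, 0\<^sub>v n) (row G1' i, row G2' i)"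
    if "i < k'" for i
    using that G row_four_block_mat(2)[OF G(1) _ _ G(3), of "0\<^sub>m k m'" "0\<^sub>m k' m" "k + i"]
      row_four_block_mat(2)[OF G(2) _ _ G(4), of "0\<^sub>m k n'" "0\<^sub>m k' n" "k + i"]
    by simp
  have rows: "matrix_rows ?B1 ?B2 = (\<lambda>x. append_pair x (0\<^sub>v m', 0\<^sub>v n')) ` matrix_rows G1 G2 \<union>
      append_pair (0\<^sub>v m, 0\<^sub>v n) ` matrix_rows G1' G2'"
    (is "_ = ?L \<union> ?R")
  proof -
    \<comment> \<open>The lower block starts at row \<open>k\<close>, so the index set is cut there
      to match \<open>row1\<close> and \<open>row2\<close>.\<close>
    have "{..<k + k'} = {..<k} \<union> (+) k ` {..<k'}"
    proof -
      have "x \<in> (+) k ` {..<k'}" if "x < k + k'" "\<not> x < k" for x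
        using that by (intro image_eqI[of _ _ "x - k"]) auto
      then show ?thesis by auto
    qed
    then have "matrix_rows ?B1 ?B2 = (\<lambda>i. (row ?B1 i, row ?B2 i)) ` ({..<k} \<union> (+) k ` {..<k'})"
      using G by (simp add: matrix_rows_image)
    also have "\<dots> = (\<lambda>i. (row ?B1 i, row ?B2 i)) ` {..<k} \<union> (\<lambda>i. (row ?B1 (k + i), row ?B2 (k + i))) ` {..<k'}"
      by (simp only: image_Un image_image)
    also have "(\<lambda>i. (row ?B1 i, row ?B2 i)) ` {..<k} = ?L"
      using G row1 by (simp add: matrix_rows_image image_image)
    also have "(\<lambda>i. (row ?B1 (k + i), row ?B2 (k + i))) ` {..<k'} = ?R"
      using G row2 by (simp add: matrix_rows_image image_image)
    finally show ?thesis .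
  qed
  \<comment> \<open>A padded row of one matrix lies in the product because the other code contains
    the zero vector.\<close>
  have rowsP: "matrix_rows ?B1 ?B2 \<subseteq> code_prod C D"
    unfolding rows using inC inD Ci Di by (auto intro!: code_prodI)
  have prod: "linear_code (m + m') (n + n') (code_prod C D)"
    using C D by (rule linear_code_code_prod)
  then have rowsA: "matrix_rows ?B1 ?B2 \<subseteq> carrier (ambient (m + m') (n + n'))"
    using rowsP by (auto simp: linear_code_iff)
  have E: "linear_code (m + m') (n + n') ?E"
    unfolding linear_code_def by (rule module.span_is_submodule[OF module_ambient rowsA])
  have rowsE: "matrix_rows ?B1 ?B2 \<subseteq> ?E"
    by (rule module.in_own_span[OF module_ambient rowsA])
  note Ei = E[unfolded linear_code_iff]
  txt \<open>The preimages of the span of the block rows under the two embeddings are submodules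
    containing the rows of either factor.\<close>
  have CE: "C \<subseteq> {x \<in> carrier_vec m \<times> carrier_vec n. append_pair x (0\<^sub>v m', 0\<^sub>v n') \<in> ?E}"
    unfolding CG using linear_code_append_zero[OF E] rowsE rowsG unfolding rows
    by (intro span_subset_linear_code) auto
  have DE: "D \<subseteq> {x \<in> carrier_vec m' \<times> carrier_vec n'. append_pair (0\<^sub>v m, 0\<^sub>v n) x \<in> ?E}"
    unfolding DG using linear_code_append_zero[OF E] rowsE rowsG unfolding rows
    by (intro span_subset_linear_code) auto
  have "code_prod C D \<subseteq> ?E"
  proof
    fix z assume "z \<in> code_prod C D"
    then obtain a b c d where z: "(a, b) \<in> C" "(c, d) \<in> D" "z = (a @\<^sub>v c, b @\<^sub>v d)"
      by (force simp: code_prod_def)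
    then have car: "a \<in> carrier_vec m" "b \<in> carrier_vec n" "c \<in> carrier_vec m'" "d \<in> carrier_vec n'"
      using Ci Di by auto
    have "(a @\<^sub>v 0\<^sub>v m', b @\<^sub>v 0\<^sub>v n') \<in> ?E" "(0\<^sub>v m @\<^sub>v c, 0\<^sub>v n @\<^sub>v d) \<in> ?E"
      using z CE DE by auto
    \<comment> \<open>A concatenation is the sum of its two padded halves.\<close>
    then have "((a @\<^sub>v 0\<^sub>v m') + (0\<^sub>v m @\<^sub>v c), (b @\<^sub>v 0\<^sub>v n') + (0\<^sub>v n @\<^sub>v d)) \<in> ?E"
      using Ei by blast
    moreover have "(a @\<^sub>v 0\<^sub>v m') + (0\<^sub>v m @\<^sub>v c) = a @\<^sub>v c" "(b @\<^sub>v 0\<^sub>v n') + (0\<^sub>v n @\<^sub>v d) = b @\<^sub>v d"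
      using car append_vec_plus[of a m "0\<^sub>v m" "0\<^sub>v m'" m' c]
        append_vec_plus[of b n "0\<^sub>v n" "0\<^sub>v n'" n' d] by simp_all
    ultimately show "z \<in> ?E"
      using z by simp
  qed
  moreover have "?E \<subseteq> code_prod C D"
    using prod rowsP by (rule span_subset_linear_code)
  ultimately show ?thesis
    using G by (simp add: generator_matrix_def)
qed

section \<open>Inner product and dual code\<close>

lemma inner_product_append_pair:
  assumes "x \<in> carrier_vec m \<times> carrier_vec n" "c \<in> carrier_vec m \<times> carrier_vec n"
    and "y \<in> carrier_vec m' \<times> carrier_vec n'" "d \<in> carrier_vec m' \<times> carrier_vec n'"
  shows "inner_product (append_pair x y) (append_pair c d) = inner_product x c + inner_product y d"
proof -
  \<comment> \<open>\<open>of_Z2\<close> is additive because R, like Z2, has characteristic 2. This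
    lets the binary part of the inner product be split before or after it is embedded in R.\<close>
  have "of_Z2 (r + s) = of_Z2 r + of_Z2 s" for r s
    by (simp add: of_Z2_def plus_z2u_def)
  then show ?thesis
    using assms
    by (auto simp: inner_product_def append_pair_def scalar_prod_append distrib_left add_ac)
qed

lemma dual_code_code_prod:
  assumes C: "linear_code m n C" and D: "linear_code m' n' D"
  shows "dual_code (m + m') (n + n') (code_prod C D) = code_prod (dual_code m n C) (dual_code m' n' D)"
proof -
  note Ci = C[unfolded linear_code_iff] and Di = D[unfolded linear_code_iff]
  have zero: "inner_product x (0\<^sub>v k, 0\<^sub>v l) = 0" if "x \<in> carrier_vec k \<times> carrier_vec l" for x k l
    using that by (auto simp: inner_product_def of_Z2_def u_def times_z2u_def zero_z2u_def)
  have "append_pair x y \<in> dual_code (m + m') (n + n') (code_prod C D) \<longleftrightarrow>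
      x \<in> dual_code m n C \<and> y \<in> dual_code m' n' D"
    if xy: "x \<in> carrier_vec m \<times> carrier_vec n" "y \<in> carrier_vec m' \<times> carrier_vec n'" for x y
  proof -
    have "append_pair x y \<in> dual_code (m + m') (n + n') (code_prod C D) \<longleftrightarrow>
        (\<forall>c\<in>C. \<forall>d\<in>D. inner_product (append_pair x y) (append_pair c d) = 0)"
      using xy by (auto simp: dual_code_def code_prod_def append_pair_def)
    also have "\<dots> \<longleftrightarrow> (\<forall>c\<in>C. \<forall>d\<in>D. inner_product x c + inner_product y d = 0)"
      using xy Ci Di by (intro ball_cong refl) (subst inner_product_append_pair, auto)
    also have "\<dots> \<longleftrightarrow> (\<forall>c\<in>C. inner_product x c = 0) \<and> (\<forall>d\<in>D. inner_product y d = 0)"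
      using Ci Di zero[OF xy(1)] zero[OF xy(2)] by (metis add_0 add.right_neutral)
    also have "\<dots> \<longleftrightarrow> x \<in> dual_code m n C \<and> y \<in> dual_code m' n' D"
      using xy by (auto simp: dual_code_def)
    finally show ?thesis .
  qed
  note mem = this
  show ?thesis
  proof (intro equalityI subsetI)
    fix z assume z: "z \<in> dual_code (m + m') (n + n') (code_prod C D)"
    then have "fst z \<in> carrier_vec (m + m')" "snd z \<in> carrier_vec (n + n')"
      by (auto simp: dual_code_def)
    \<comment> \<open>\<open>mem\<close> applies only to vectors already given as a concatenation,
      so a vector of the large ambient module is cut after \<open>m\<close> binary and
      \<open>n\<close> further coordinates.\<close>
    then obtain x y where "x \<in> carrier_vec m \<times> carrier_vec n" "y \<in> carrier_vec m' \<times> carrier_vec n'"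
      "z = append_pair x y"
      by (elim carrier_vec_add_cases) (metis append_pair_simps mem_Sigma_iff prod.collapse)
    with mem z show "z \<in> code_prod (dual_code m n C) (dual_code m' n' D)"
      by (force simp: code_prod_def)
  next
    fix z assume "z \<in> code_prod (dual_code m n C) (dual_code m' n' D)"
    then obtain x y where "x \<in> dual_code m n C" "y \<in> dual_code m' n' D" "z = append_pair x y"
      by (auto simp: code_prod_def)
    with mem show "z \<in> dual_code (m + m') (n + n') (code_prod C D)"
      by (auto simp: dual_code_def)
  qed
qed

text \<open>The common lengths of the left components fix the place of the cut, and the right
  components are what remains after it.\<close>

lemma inj_on_append_pair:
  assumes "C \<subseteq> carrier_vec m \<times> carrier_vec n"
  shows "inj_on (\<lambda>(x, y). append_pair x y) (C \<times> D)"
proof -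
  have "x = x' \<and> y = y'" if "append_pair x y = append_pair x' y'" "x \<in> C" "x' \<in> C" for x x' y y'
  proof -
    have "fst x \<in> carrier_vec m" "fst x' \<in> carrier_vec m" "snd x \<in> carrier_vec n" "snd x' \<in> carrier_vec n"
      using that assms by auto
    then show ?thesis
      using that(1) by (auto simp: append_pair_def prod_eq_iff)
  qed
  note eq = this
  show ?thesis
  proof (rule inj_onI)
    fix p q
    assume "p \<in> C \<times> D" "q \<in> C \<times> D"
      "(case p of (x, y) \<Rightarrow> append_pair x y) = (case q of (x, y) \<Rightarrow> append_pair x y)"
    then show "p = q"
      using eq[of "fst p" "snd p" "fst q" "snd q"] by (simp add: case_prod_beta mem_Times_iff prod_eq_iff)
  qed
qed

section \<open>Lee weight and weight enumerator\<close>

lemma sum_lessThan_add: "(\<Sum>i<m + n. f i) = (\<Sum>i<m. f i) + (\<Sum>i<n. f (m + i))"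
  for m n :: nat and f :: "nat \<Rightarrow> 'a :: comm_monoid_add"
  by (induction n) (simp_all add: add_ac)

text \<open>In this form the Hamming weight splits over a concatenation by the same index shift as
  the Lee part.\<close>

lemma hamming_weight_eq_sum: "hamming_weight v = (\<Sum>i<dim_vec v. if v $ i \<noteq> 0 then 1 else 0)"
proof -
  have "{i. i < dim_vec v \<and> v $ i \<noteq> 0} = {..<dim_vec v} \<inter> {i. v $ i \<noteq> 0}"
    by auto
  then show ?thesis
    by (simp add: hamming_weight_def sum.If_cases)
qed

lemma lee_weight_append_pair: "lee_weight (append_pair x y) = lee_weight x + lee_weight y"
  by (simp add: lee_weight_def hamming_weight_eq_sum append_pair_def sum_lessThan_add)

text \<open>The exponent of X is a truncated difference; this bound makes it a true one, so that
  exponents add.\<close>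

lemma lee_weight_le:
  assumes "x \<in> carrier_vec m \<times> carrier_vec n"
  shows "lee_weight x \<le> m + 2 * n"
proof -
  have "hamming_weight (fst x) \<le> (\<Sum>i<dim_vec (fst x). 1)"
    unfolding hamming_weight_eq_sum by (rule sum_mono) simp
  moreover have "(\<Sum>j<dim_vec (snd x). lee_weight_R (snd x $ j)) \<le> (\<Sum>j<dim_vec (snd x). 2)"
    by (rule sum_mono) (simp add: lee_weight_R_def)
  ultimately show ?thesis
    using assms by (auto simp: lee_weight_def)
qed

lemma weight_enumerator_code_prod:
  assumes C: "C \<subseteq> carrier_vec m \<times> carrier_vec n" and D: "D \<subseteq> carrier_vec m' \<times> carrier_vec n'"
  shows "weight_enumerator (m + m') (n + n') (code_prod C D) =
    weight_enumerator m n C * weight_enumerator m' n' D"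
proof -
  \<comment> \<open>The length is a parameter since three lengths occur: those of the two factors
    and their sum.\<close>
  define W where "W k x = var_X ^ (k - lee_weight x) * var_Y ^ lee_weight x" for k x
  have "W ((m + 2 * n) + (m' + 2 * n')) (append_pair x y) = W (m + 2 * n) x * W (m' + 2 * n') y"
    if "x \<in> C" "y \<in> D" for x y
  proof -
    have le: "lee_weight x \<le> m + 2 * n" "lee_weight y \<le> m' + 2 * n'"
      using that C D lee_weight_le by blast+
    then have "(m + 2 * n) + (m' + 2 * n') - (lee_weight x + lee_weight y) =
        (m + 2 * n - lee_weight x) + (m' + 2 * n' - lee_weight y)"
      by simp
    then show ?thesis
      by (simp only: W_def lee_weight_append_pair power_add ac_simps)
  qed
  \<comment> \<open>By injectivity each codeword of the product comes from exactly one pair, so the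
    sum can be reindexed by pairs.\<close>
  then have "(\<Sum>c\<in>code_prod C D. W ((m + 2 * n) + (m' + 2 * n')) c) =
      (\<Sum>(x, y)\<in>C \<times> D. W (m + 2 * n) x * W (m' + 2 * n') y)"
    unfolding code_prod_def
    by (subst sum.reindex[OF inj_on_append_pair[OF C]]) (auto intro!: sum.cong)
  also have "\<dots> = (\<Sum>x\<in>C. W (m + 2 * n) x) * (\<Sum>y\<in>D. W (m' + 2 * n') y)"
    by (simp add: sum_product sum.cartesian_product)
  finally show ?thesis
    by (simp add: weight_enumerator_def W_def algebra_simps)
qed

section \<open>Module isomorphisms and the parameters \<gamma>, \<delta>\<close>

lemma module_iso_trans [trans]:
  assumes "module_iso R M N" and "module_iso R N P"
  shows "module_iso R M P"
proof -
  obtain f g where "f \<in> LinearCombinations.module_hom R M N" "bij_betw f (carrier M) (carrier N)"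
    "g \<in> LinearCombinations.module_hom R N P" "bij_betw g (carrier N) (carrier P)"
    using assms by (auto simp: module_iso_def)
  then have "g \<circ> f \<in> LinearCombinations.module_hom R M P" "bij_betw (g \<circ> f) (carrier M) (carrier P)"
    by (auto simp: LinearCombinations.module_hom_def Pi_iff intro: bij_betw_trans)
  then show ?thesis
    unfolding module_iso_def by blast
qed

text \<open>The module axioms for \<open>M\<close> supply closure: \<open>g x \<oplus> g y\<close>
  and \<open>r \<odot> g x\<close> stay in its carrier, where \<open>g\<close> cancels
  \<open>f\<close>. Applying \<open>f\<close> to them gives the corresponding expressions in
  \<open>N\<close>.\<close>

lemma module_iso_sym:
  assumes "module R M" and "module_iso R M N"
  shows "module_iso R N M"
proof -
  interpret Module.module R M by fact
  obtain f where f: "f \<in> LinearCombinations.module_hom R M N" and bij: "bij_betw f (carrier M) (carrier N)"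
    using assms(2) by (auto simp: module_iso_def)
  define g where "g = inv_into (carrier M) f"
  have g: "g y \<in> carrier M" "f (g y) = y" if "y \<in> carrier N" for y
    using that bij by (auto simp: g_def bij_betw_def inv_into_into f_inv_into_f)
  have gf: "g (f x) = x" if "x \<in> carrier M" for x
    using that bij by (simp add: g_def bij_betw_def)
  have "g (x \<oplus>\<^bsub>N\<^esub> y) = g x \<oplus>\<^bsub>M\<^esub> g y" if "x \<in> carrier N" "y \<in> carrier N" for x y
    using g that gf[of "g x \<oplus>\<^bsub>M\<^esub> g y"] LinearCombinations.module_hom_add[OF f, of "g x" "g y"] by simp
  moreover have "g (r \<odot>\<^bsub>N\<^esub> x) = r \<odot>\<^bsub>M\<^esub> g x" if "r \<in> carrier R" "x \<in> carrier N" for r x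
    using g that gf[of "r \<odot>\<^bsub>M\<^esub> g x"] LinearCombinations.module_hom_smult[OF f, of r "g x"] by simp
  ultimately have "g \<in> LinearCombinations.module_hom R N M"
    using g by (simp add: LinearCombinations.module_hom_def)
  moreover have "bij_betw g (carrier N) (carrier M)"
    unfolding g_def using bij by (rule bij_betw_inv_into)
  ultimately show ?thesis
    unfolding module_iso_def by blast
qed

lemma module_iso_direct_sum:
  assumes "module_iso R M M'" and "module_iso R N N'"
  shows "module_iso R (direct_sum M N) (direct_sum M' N')"
proof -
  obtain f g where "f \<in> LinearCombinations.module_hom R M M'" "bij_betw f (carrier M) (carrier M')"
    "g \<in> LinearCombinations.module_hom R N N'" "bij_betw g (carrier N) (carrier N')"
    using assms by (auto simp: module_iso_def)
  then have "map_prod f g \<in> LinearCombinations.module_hom R (direct_sum M N) (direct_sum M' N')"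
    "bij_betw (map_prod f g) (carrier (direct_sum M N)) (carrier (direct_sum M' N'))"
    by (auto simp: LinearCombinations.module_hom_def Pi_iff intro: bij_betw_map_prod)
  then show ?thesis
    unfolding module_iso_def by blast
qed

text \<open>The map starts at the direct sum because concatenation has a formula; the inverse would
  have to name the cut.\<close>

lemma module_iso_code_prod:
  assumes "linear_code m n C" and "linear_code m' n' D"
  shows "module_iso class_ring
    (direct_sum ((ambient m n)\<lparr>carrier := C\<rparr>) ((ambient m' n')\<lparr>carrier := D\<rparr>))
    ((ambient (m + m') (n + n'))\<lparr>carrier := code_prod C D\<rparr>)"
proof -
  have CD: "C \<subseteq> carrier_vec m \<times> carrier_vec n" "D \<subseteq> carrier_vec m' \<times> carrier_vec n'"
    using assms by (auto simp: linear_code_iff)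
  have "append_pair (fst x + fst c, snd x + snd c) (fst y + fst d, snd y + snd d) =
      (fst (append_pair x y) + fst (append_pair c d), snd (append_pair x y) + snd (append_pair c d))"
    if "x \<in> C" "c \<in> C" "y \<in> D" "d \<in> D" for x y c d
  proof -
    have "fst x \<in> carrier_vec m" "fst c \<in> carrier_vec m" "fst y \<in> carrier_vec m'" "fst d \<in> carrier_vec m'"
      "snd x \<in> carrier_vec n" "snd c \<in> carrier_vec n" "snd y \<in> carrier_vec n'" "snd d \<in> carrier_vec n'"
      using that CD by auto
    then show ?thesis
      by (simp add: append_pair_def append_vec_plus)
  qed
  then have "(\<lambda>(x, y). append_pair x y) \<in> LinearCombinations.module_hom class_ring
      (direct_sum ((ambient m n)\<lparr>carrier := C\<rparr>) ((ambient m' n')\<lparr>carrier := D\<rparr>))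
      ((ambient (m + m') (n + n'))\<lparr>carrier := code_prod C D\<rparr>)"
    by (force simp: LinearCombinations.module_hom_def append_pair_def smult_append_vec intro!: code_prodI)
  moreover have "bij_betw (\<lambda>(x, y). append_pair x y) (C \<times> D) (code_prod C D)"
    using inj_on_append_pair[OF CD(1)] by (simp add: bij_betw_def code_prod_def)
  ultimately show ?thesis
    unfolding module_iso_def by auto
qed

text \<open>Four summands are regrouped by kind: powers of \<open>M\<close> with powers of
  \<open>M\<close>, free parts with free parts. All operations are entrywise, so concatenation
  commutes with them.\<close>

lemma module_iso_append_power_module:
  "module_iso R
    (direct_sum (direct_sum (power_module M k) (module_vec TYPE('a :: semiring_1) l))
      (direct_sum (power_module M k') (module_vec TYPE('a) l')))
    (direct_sum (power_module M (k + k')) (module_vec TYPE('a) (l + l')))"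
  (is "module_iso R (direct_sum ?N ?N') ?P")
proof -
  let ?f = "\<lambda>(x, y). append_pair x y"
  \<comment> \<open>Operations of \<open>power_module\<close> produce vectors built by
    \<open>vec\<close>; merging two of them into one lets the sides be compared entry by
    entry.\<close>
  have "(vec k f) @\<^sub>v (vec k' g) = vec (k + k') (\<lambda>i. if i < k then f i else g (i - k))" for f g :: "nat \<Rightarrow> 'c"
    by (intro eq_vecI) auto
  then have "?f \<in> LinearCombinations.module_hom R (direct_sum ?N ?N') ?P"
    by (auto simp: LinearCombinations.module_hom_def module_vec_simps smult_append_vec append_vec_plus intro!: eq_vecI)
  moreover have "bij_betw ?f (carrier (direct_sum ?N ?N')) (carrier ?P)"
    unfolding bij_betw_def
  proof
    have "carrier ?N \<subseteq> carrier_vec k \<times> carrier_vec l"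
      by (auto simp: module_vec_simps)
    then show "inj_on ?f (carrier (direct_sum ?N ?N'))"
      using inj_on_append_pair[of "carrier ?N" k l "carrier ?N'"] by simp
    show "?f ` carrier (direct_sum ?N ?N') = carrier ?P"
    proof (intro equalityI subsetI)
      fix z assume "z \<in> ?f ` carrier (direct_sum ?N ?N')"
      then show "z \<in> carrier ?P"
        by (auto simp: module_vec_simps)
    next
      fix z assume z: "z \<in> carrier ?P"
      obtain v v' where v: "v \<in> carrier_vec k" "v' \<in> carrier_vec k'" "fst z = v @\<^sub>v v'"
        using z by (auto elim: carrier_vec_add_cases)
      obtain w w' where w: "w \<in> carrier_vec l" "w' \<in> carrier_vec l'" "snd z = w @\<^sub>v w'"
        using z by (auto simp: module_vec_simps elim: carrier_vec_add_cases)
      \<comment> \<open>The carrier of a power restricts every entry, so both halves must inherit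
        the restriction: \<open>v\<close> at the same index, \<open>v'\<close> at the index shifted
        by \<open>k\<close>.\<close>
      have entry: "(v @\<^sub>v v') $ i \<in> carrier M" if "i < k + k'" for i
        using z v that by auto
      have "v $ i \<in> carrier M" if "i < k" for i
        using entry[of i] v that by simp
      moreover have "v' $ i \<in> carrier M" if "i < k'" for i
        using entry[of "k + i"] v that by simp
      ultimately have "((v, w), (v', w')) \<in> carrier (direct_sum ?N ?N')"
        using v w by (simp add: module_vec_simps)
      moreover have "z = ?f ((v, w), (v', w'))"
        using v w by (simp add: prod_eq_iff)
      ultimately show "z \<in> ?f ` carrier (direct_sum ?N ?N')"
        by blast
    qed
  qed
  ultimately show ?thesis
    unfolding module_iso_def by blast
qed

section \<open>The binary projection of the subcode with entries in {0, u}, and \<kappa>\<close>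

lemma mem_subcode_b_code_prod:
  "(a, b) \<in> subcode_b (code_prod C D) \<longleftrightarrow>
    (\<exists>v w v' w'. (v, w) \<in> subcode_b C \<and> (v', w') \<in> subcode_b D \<and> a = v @\<^sub>v v' \<and> b = w @\<^sub>v w')"
proof -
  \<comment> \<open>The condition cutting out the subcode concerns the R part alone, and it holds
    for a concatenation exactly when it holds for both halves.\<close>
  define P where "P w \<longleftrightarrow> (\<forall>j<dim_vec w. w $ j \<in> {0, u})" for w :: "z2u vec"
  have sub: "(a, b) \<in> subcode_b X \<longleftrightarrow> (a, b) \<in> X \<and> P b" for a b X
    by (simp add: subcode_b_def P_def)
  have P: "P (w @\<^sub>v w') \<longleftrightarrow> P w \<and> P w'" for w w'
  proof
    assume L: "P (w @\<^sub>v w')"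
    have "w $ j \<in> {0, u}" if "j < dim_vec w" for j
      using L[unfolded P_def, rule_format, of j] that by simp
    moreover have "w' $ j \<in> {0, u}" if "j < dim_vec w'" for j
      using L[unfolded P_def, rule_format, of "dim_vec w + j"] that by simp
    ultimately show "P w \<and> P w'"
      unfolding P_def by blast
  next
    assume "P w \<and> P w'"
    then show "P (w @\<^sub>v w')"
      by (simp add: P_def)
  qed
  show ?thesis
    unfolding sub mem_code_prod_iff using P by blast
qed

lemma fst_subcode_b_code_prod:
  "fst ` subcode_b (code_prod C D) =
    (\<lambda>(a, c). a @\<^sub>v c) ` (fst ` subcode_b C \<times> fst ` subcode_b D)"
proof -
  have mem: "v \<in> fst ` S \<longleftrightarrow> (\<exists>w. (v, w) \<in> S)" for v and S :: "(bit vec \<times> z2u vec) set"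
    by force
  have image: "x \<in> (\<lambda>(a, c). a @\<^sub>v c) ` (A \<times> B) \<longleftrightarrow> (\<exists>a c. a \<in> A \<and> c \<in> B \<and> x = a @\<^sub>v c)"
    for x :: "bit vec" and A B
    by auto
  show ?thesis
    by (rule Set.set_eqI) (unfold image mem mem_subcode_b_code_prod, blast)
qed

text \<open>The projection must be a subspace over Z2, while the code is a module over R. The two
  are reconciled by lifting scalars along \<open>of_Z2\<close>; the set {0, u} is closed under
  addition and under the lifted scalars.\<close>

lemma submodule_fst_subcode_b:
  assumes "linear_code m n C"
  shows "LinearCombinations.submodule class_ring (fst ` subcode_b C) (module_vec TYPE(bit) m)"
proof -
  note C = assms[unfolded linear_code_iff]
  have mem: "v \<in> fst ` subcode_b C \<longleftrightarrow>
      (\<exists>w. (v, w) \<in> C \<and> w \<in> carrier_vec n \<and> (\<forall>j<n. w $ j \<in> {0, u}))" for v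
    using C by (force simp: subcode_b_def image_iff)
  show ?thesis
  proof (rule submodule.intro)
    show "module class_ring (module_vec TYPE(bit) m)"
      by (rule vec_module)
    show "fst ` subcode_b C \<subseteq> carrier (module_vec TYPE(bit) m)"
      using C by (auto simp: module_vec_simps subcode_b_def)
    show "\<zero>\<^bsub>module_vec TYPE(bit) m\<^esub> \<in> fst ` subcode_b C"
      unfolding mem using C by (auto simp: module_vec_simps intro!: exI[of _ "0\<^sub>v n"])
  next
    fix v v' assume "v \<in> fst ` subcode_b C" "v' \<in> fst ` subcode_b C"
    then obtain w w' where w: "(v, w) \<in> C" "w \<in> carrier_vec n" "\<forall>j<n. w $ j \<in> {0, u}"
      "(v', w') \<in> C" "w' \<in> carrier_vec n" "\<forall>j<n. w' $ j \<in> {0, u}"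
      unfolding mem by blast
    moreover have "x + y \<in> {0, u}" if "x \<in> {0, u}" "y \<in> {0, u}" for x y
      using that by (auto simp: u_def zero_z2u_def plus_z2u_def)
    ultimately have "\<forall>j<n. (w + w') $ j \<in> {0, u}"
      by simp
    moreover have "(v + v', w + w') \<in> C"
      using C w by blast
    ultimately have "v + v' \<in> fst ` subcode_b C"
      unfolding mem using w by (intro exI[of _ "w + w'"]) simp
    then show "v \<oplus>\<^bsub>module_vec TYPE(bit) m\<^esub> v' \<in> fst ` subcode_b C"
      by (simp add: module_vec_simps)
  next
    fix c :: bit and v assume "v \<in> fst ` subcode_b C"
    then obtain w where w: "(v, w) \<in> C" "w \<in> carrier_vec n" "\<forall>j<n. w $ j \<in> {0, u}"
      unfolding mem by blast
    moreover have "of_Z2 c * x \<in> {0, u}" if "x \<in> {0, u}" for x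
      using that by (cases c) (auto simp: of_Z2_def u_def zero_z2u_def times_z2u_def)
    ultimately have "\<forall>j<n. (of_Z2 c \<cdot>\<^sub>v w) $ j \<in> {0, u}"
      by simp
    \<comment> \<open>The lifted scalar acts on the binary part through \<open>eta\<close>, which
      returns the original bit.\<close>
    moreover have "(c \<cdot>\<^sub>v v, of_Z2 c \<cdot>\<^sub>v w) \<in> C"
    proof -
      have "(eta (of_Z2 c) \<cdot>\<^sub>v v, of_Z2 c \<cdot>\<^sub>v w) \<in> C"
        using C w by blast
      then show ?thesis
        by (simp add: of_Z2_def)
    qed
    ultimately have "c \<cdot>\<^sub>v v \<in> fst ` subcode_b C"
      unfolding mem using w by (intro exI[of _ "of_Z2 c \<cdot>\<^sub>v w"]) simp
    then show "c \<odot>\<^bsub>module_vec TYPE(bit) m\<^esub> v \<in> fst ` subcode_b C"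
      by (simp add: module_vec_simps)
  qed
qed

text \<open>The carrier itself is a finite generating set.\<close>

lemma (in vectorspace) finite_imp_fin_dim:
  assumes "finite (carrier V)"
  shows fin_dim
proof -
  have "span (carrier V) = carrier V"
    by (intro equalityI in_own_span span_is_subset2 subset_refl)
  with assms show ?thesis
    unfolding fin_dim_def by blast
qed

lemma dim_module_iso:
  fixes K :: "('a, 'k) ring_scheme" and V :: "('a, 'v) module" and W :: "('a, 'w) module"
  assumes V: "vectorspace K V" and W: "vectorspace K W" and "vectorspace.fin_dim K V"
    and "module_iso K V W"
  shows "vectorspace.dim K V = vectorspace.dim K W"
proof -
  obtain f where f: "f \<in> LinearCombinations.module_hom K V W" and bij: "bij_betw f (carrier V) (carrier W)"
    using assms(4) by (auto simp: module_iso_def)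
  interpret V: vectorspace K V by fact
  interpret W: vectorspace K W by fact
  interpret linear_map K V W f
    by unfold_locales (rule f)
  show ?thesis
    using assms(3) bij by (intro dim_eq) (simp_all add: bij_betw_def)
qed

text \<open>Rank-nullity for the first projection, whose kernel is a copy of the second summand.\<close>

lemma dim_direct_sum:
  fixes K :: "('a, 'k) ring_scheme" and V :: "('a, 'v) module" and W :: "('a, 'w) module"
  assumes V: "vectorspace K V" and W: "vectorspace K W"
    and fin: "finite (carrier V)" "finite (carrier W)"
  shows "vectorspace.dim K (direct_sum V W) = vectorspace.dim K V + vectorspace.dim K W"
proof -
  let ?S = "direct_sum V W"
  interpret V: vectorspace K V by fact
  interpret W: vectorspace K W by fact
  interpret S: vectorspace K ?S
    using V W by (rule direct_sum_is_vs)
  interpret linear_map K ?S V fst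
    by unfold_locales (auto simp: LinearCombinations.module_hom_def)
  have im: "im = carrier V"
    by (force simp: im_def image_iff)
  have ker: "ker = {\<zero>\<^bsub>V\<^esub>} \<times> carrier W"
    by (auto simp: ker_def)
  have "Pair \<zero>\<^bsub>V\<^esub> \<in> LinearCombinations.module_hom K W (?S\<lparr>carrier := ker\<rparr>)"
    by (auto simp: LinearCombinations.module_hom_def ker)
  moreover have "bij_betw (Pair \<zero>\<^bsub>V\<^esub>) (carrier W) ker"
    by (auto simp: ker bij_betw_def inj_on_def)
  ultimately have "module_iso K W (?S\<lparr>carrier := ker\<rparr>)"
    unfolding module_iso_def by auto
  then have "vectorspace.dim K W = vectorspace.dim K (?S\<lparr>carrier := ker\<rparr>)"
    by (intro dim_module_iso W S.subspace_is_vs kerT_is_subspace W.finite_imp_fin_dim fin)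
  moreover have "vectorspace.dim K (V\<lparr>carrier := im\<rparr>) + vectorspace.dim K (?S\<lparr>carrier := ker\<rparr>) = S.dim"
    using fin by (intro rank_nullity S.finite_imp_fin_dim) simp
  ultimately show ?thesis
    by (simp add: im)
qed

text \<open>Every projected subcode is thereby finite, which provides the finite dimension behind
  the comparison and addition of dimensions.\<close>

lemma finite_carrier_vec_bit: "finite (carrier_vec m :: bit vec set)"
proof -
  have "finite (UNIV :: bit set)"
  proof (rule finite_subset)
    show "(UNIV :: bit set) \<subseteq> {0, 1}"
      using bit.exhaust by auto
  qed simp
  then have "finite {xs :: bit list. set xs \<subseteq> UNIV \<and> length xs = m}"
    by (rule finite_lists_length_eq)
  moreover have "carrier_vec m \<subseteq> vec_of_list ` {xs :: bit list. set xs \<subseteq> UNIV \<and> length xs = m}"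
  proof
    fix v :: "bit vec" assume "v \<in> carrier_vec m"
    then show "v \<in> vec_of_list ` {xs. set xs \<subseteq> UNIV \<and> length xs = m}"
      by (intro image_eqI[of _ _ "list_of_vec v"]) (auto simp: vec_list)
  qed
  ultimately show ?thesis
    by (rule finite_surj)
qed

text \<open>Concatenation of binary words maps the direct sum of the two projected subcodes linearly
  and bijectively onto that of the product, so the dimensions add.\<close>

lemma code_kappa_code_prod:
  assumes C: "linear_code m n C" and D: "linear_code m' n' D"
  shows "code_kappa (m + m') (code_prod C D) = code_kappa m C + code_kappa m' D"
proof -
  let ?V = "\<lambda>k X. (module_vec TYPE(bit) k)\<lparr>carrier := fst ` subcode_b X\<rparr>"
  \<comment> \<open>Stated for an arbitrary linear code, as it is applied to both factors and to
    their product.\<close>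
  have vs: "vectorspace class_ring (?V k X)" and sub: "fst ` subcode_b X \<subseteq> carrier_vec k"
    if "linear_code k l X" for k l X
  proof -
    interpret vectorspace class_ring "module_vec TYPE(bit) k"
      by (rule vec_vs)
    have "submodule class_ring (fst ` subcode_b X) (module_vec TYPE(bit) k)"
      using that by (rule submodule_fst_subcode_b)
    then show "fst ` subcode_b X \<subseteq> carrier_vec k"
      by (auto simp: submodule_def module_vec_simps)
    show "vectorspace class_ring (?V k X)"
      by (rule subspace_is_vs, rule subspace.intro[OF vec_vs submodule_fst_subcode_b[OF that]])
  qed
  have fin: "finite (fst ` subcode_b X)" if "linear_code k l X" for k l X
    using sub[OF that] finite_carrier_vec_bit by (rule finite_subset)
  note CD = vs[OF C] vs[OF D] vs[OF linear_code_code_prod[OF C D]]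
  have "module_iso class_ring (direct_sum (?V m C) (?V m' D)) (?V (m + m') (code_prod C D))"
  proof -
    let ?f = "\<lambda>(a :: bit vec, c). a @\<^sub>v c"
    note car = subsetD[OF sub[OF C]] subsetD[OF sub[OF D]]
    have "inj_on ?f (fst ` subcode_b C \<times> fst ` subcode_b D)"
    proof (rule inj_onI)
      fix p q
      assume "p \<in> fst ` subcode_b C \<times> fst ` subcode_b D" "q \<in> fst ` subcode_b C \<times> fst ` subcode_b D"
        and eq: "?f p = ?f q"
      then have "fst p \<in> carrier_vec m" "fst q \<in> carrier_vec m"
        using car by (simp_all add: mem_Times_iff)
      then show "p = q"
        using eq by (simp add: case_prod_beta prod_eq_iff)
    qed
    then have "bij_betw ?f (carrier (direct_sum (?V m C) (?V m' D))) (carrier (?V (m + m') (code_prod C D)))"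
      by (simp add: bij_betw_def fst_subcode_b_code_prod)
    moreover have "?f \<in> LinearCombinations.module_hom class_ring
        (direct_sum (?V m C) (?V m' D)) (?V (m + m') (code_prod C D))"
      unfolding LinearCombinations.module_hom_def
    proof (intro CollectI conjI allI impI)
      show "?f \<in> carrier (direct_sum (?V m C) (?V m' D)) \<rightarrow> carrier (?V (m + m') (code_prod C D))"
        by (auto simp: fst_subcode_b_code_prod)
    next
      fix p q
      assume "p \<in> carrier (direct_sum (?V m C) (?V m' D)) \<and> q \<in> carrier (direct_sum (?V m C) (?V m' D))"
      then have "fst p \<in> carrier_vec m" "fst q \<in> carrier_vec m" "snd p \<in> carrier_vec m'" "snd q \<in> carrier_vec m'"
        using car by (auto simp: mem_Times_iff)
      then show "?f (p \<oplus>\<^bsub>direct_sum (?V m C) (?V m' D)\<^esub> q) =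
          ?f p \<oplus>\<^bsub>?V (m + m') (code_prod C D)\<^esub> ?f q"
        by (simp add: case_prod_beta module_vec_simps append_vec_plus)
    qed (simp add: case_prod_beta module_vec_simps smult_append_vec)
    ultimately show ?thesis
      unfolding module_iso_def by blast
  qed
  then have "vectorspace.dim class_ring (direct_sum (?V m C) (?V m' D)) =
      vectorspace.dim class_ring (?V (m + m') (code_prod C D))"
    using CD fin[OF C] fin[OF D]
    by (intro dim_module_iso vectorspace.finite_imp_fin_dim direct_sum_is_vs) simp_all
  then show ?thesis
    unfolding code_kappa_def using CD fin[OF C] fin[OF D] by (simp add: dim_direct_sum)
qed

section \<open>The type of the product, and the conclusion\<close>

lemma has_type_code_prod:
  assumes C: "has_type m n g d k C" and D: "has_type m' n' g' d' k' D"
  shows "has_type (m + m') (n + n') (g + g') (d + d') (k + k') (code_prod C D)"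
proof -
  let ?A = "(ambient m n)\<lparr>carrier := C\<rparr>" and ?A' = "(ambient m' n')\<lparr>carrier := D\<rparr>"
  let ?P = "\<lambda>g d. direct_sum (power_module R_mod_uR g) (module_vec TYPE(z2u) d)"
  let ?M = "(ambient (m + m') (n + n'))\<lparr>carrier := code_prod C D\<rparr>"
  have lin: "linear_code m n C" "linear_code m' n' D"
    and iso: "module_iso class_ring ?A (?P g d)" "module_iso class_ring ?A' (?P g' d')"
    and kappa: "k = code_kappa m C" "k' = code_kappa m' D"
    using C D by (auto simp: has_type_def)
  \<comment> \<open>The chain below begins at the product code, whereas concatenation ends there. It
    has to be inverted, which calls for the module structure of the direct sum.\<close>
  have "module class_ring ?A" "module class_ring ?A'"
    using lin by (auto simp: linear_code_def intro: module.submodule_is_module[OF module_ambient])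
  then have "module class_ring (direct_sum ?A ?A')"
    by (rule direct_sum_is_module)
  then have "module_iso class_ring ?M (direct_sum ?A ?A')"
    using module_iso_code_prod[OF lin] by (rule module_iso_sym)
  also have "module_iso class_ring (direct_sum ?A ?A') (direct_sum (?P g d) (?P g' d'))"
    using iso by (rule module_iso_direct_sum)
  also have "module_iso class_ring (direct_sum (?P g d) (?P g' d')) (?P (g + g') (d + d'))"
    by (rule module_iso_append_power_module)
  finally have "module_iso class_ring ?M (?P (g + g') (d + d'))" .
  then show ?thesis
    using lin kappa by (simp add: has_type_def linear_code_code_prod code_kappa_code_prod)
qed

text \<open>\<open>generator_matrix\<close> determines \<open>M\<close> as the span of the block
  rows, so the existential quantifier only gives a name to that code; the witness is
  \<open>code_prod C C'\<close>.\<close>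

theorem theorem3p1:
  fixes \<alpha> \<beta> \<gamma> \<delta> \<kappa> \<alpha>' \<beta>' \<gamma>' \<delta>' \<kappa>' :: nat
    and C C' :: "(bit vec \<times> z2u vec) set"
    and G1 G1' :: "bit mat" and G2 G2' :: "z2u mat"
  assumes "self_dual \<alpha> \<beta> C"
    and "has_type \<alpha> \<beta> \<gamma> \<delta> \<kappa> C"
    and "generator_matrix \<alpha> \<beta> (\<gamma> + \<delta>) G1 G2 C"
    and "self_dual \<alpha>' \<beta>' C'"
    and "has_type \<alpha>' \<beta>' \<gamma>' \<delta>' \<kappa>' C'"
    and "generator_matrix \<alpha>' \<beta>' (\<gamma>' + \<delta>') G1' G2' C'"
  shows "\<exists>M. generator_matrix (\<alpha> + \<alpha>') (\<beta> + \<beta>') ((\<gamma> + \<gamma>') + (\<delta> + \<delta>'))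
        (four_block_mat G1 (0\<^sub>m (\<gamma> + \<delta>) \<alpha>') (0\<^sub>m (\<gamma>' + \<delta>') \<alpha>) G1')
        (four_block_mat G2 (0\<^sub>m (\<gamma> + \<delta>) \<beta>') (0\<^sub>m (\<gamma>' + \<delta>') \<beta>) G2') M
      \<and> self_dual (\<alpha> + \<alpha>') (\<beta> + \<beta>') M
      \<and> has_type (\<alpha> + \<alpha>') (\<beta> + \<beta>') (\<gamma> + \<gamma>') (\<delta> + \<delta>') (\<kappa> + \<kappa>') M
      \<and> weight_enumerator (\<alpha> + \<alpha>') (\<beta> + \<beta>') M
          = weight_enumerator \<alpha> \<beta> C * weight_enumerator \<alpha>' \<beta>' C'"
proof -
  have lin: "linear_code \<alpha> \<beta> C" "linear_code \<alpha>' \<beta>' C'"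
    and dual: "C = dual_code \<alpha> \<beta> C" "C' = dual_code \<alpha>' \<beta>' C'"
    using assms(1,4) by (simp_all add: self_dual_def)
  \<comment> \<open>The dual of the product is the product of the duals, in which each factor equals
    its own dual.\<close>
  have "self_dual (\<alpha> + \<alpha>') (\<beta> + \<beta>') (code_prod C C')"
    unfolding self_dual_def dual_code_code_prod[OF lin]
    using linear_code_code_prod[OF lin] dual by simp
  moreover have "generator_matrix (\<alpha> + \<alpha>') (\<beta> + \<beta>') ((\<gamma> + \<gamma>') + (\<delta> + \<delta>'))
      (four_block_mat G1 (0\<^sub>m (\<gamma> + \<delta>) \<alpha>') (0\<^sub>m (\<gamma>' + \<delta>') \<alpha>) G1')
      (four_block_mat G2 (0\<^sub>m (\<gamma> + \<delta>) \<beta>') (0\<^sub>m (\<gamma>' + \<delta>') \<beta>) G2') (code_prod C C')"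
    \<comment> \<open>Only the number of rows is rearranged: (\<gamma> + \<delta>) + (\<gamma>' +
      \<delta>') is the sum of the new parameters.\<close>
    using generator_matrix_code_prod[OF assms(3,6) lin] by (simp add: ac_simps)
  moreover have "weight_enumerator (\<alpha> + \<alpha>') (\<beta> + \<beta>') (code_prod C C') =
      weight_enumerator \<alpha> \<beta> C * weight_enumerator \<alpha>' \<beta>' C'"
    using lin by (intro weight_enumerator_code_prod) (simp_all add: linear_code_iff)
  ultimately show ?thesis
    using has_type_code_prod[OF assms(2,5)] by blast
qed

end
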